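(* The set of free loci of noncommutative polynomials in $\Bbbk\langle x_1,\dots,x_g\rangle$ coincides with the set of free loci of flip-poly pencils in the variables $x_1,\dots,x_g$.
   Context: $\Bbbk$ is an algebraically closed field of characteristic $0$; $\Bbbk\langle x_1,\dots,x_g\rangle$ is the free associative unital $\Bbbk$-algebra on $g$ freely noncommuting variables, whose elements are called noncommutative polynomials; they are evaluated at tuples $X\in M_n(\Bbbk)^g$ in the usual way. A monic pencil of size $d$ is $L=I_d-\sum_{j=1}^gA_jx_j$ with $A_j\in M_d(\Bbbk)$, evaluated at $X\in M_n(\Bbbk)^g$ as $L(X)=I_{dn}-\sum_jA_j\otimes X_j$, where $\otimes$ is the Kronecker product. For $h$ a noncommutative polynomial or a monic pencil, its free locus is $\mathscr{Z}(h)=\bigcup_{n\in\mathbb{N}}\{X\in M_n(\Bbbk)^g:\det h(X)=0\}$. Matrices are jointly nilpotent if for some $N$ all products of $N$ of them vanish. A monic pencil $L=I-\sum_jA_jx_j$ is flip-poly if $A_j=N_j+E_j$ for all $j$, where $N_1,\dots,N_g$ are jointly nilpotent matrices and $\operatorname{codim}\bigl(\bigcap_j\ker E_j\bigr)\le1$.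
   Formalization: Only noncommutative polynomials with nonzero constant term are considered; if f(0)=0 (e.g. f=x_1), the zero tuple lies in the free locus of f but never in that of a monic pencil, so the claim fails for exactly these f. *)

theory Defs
  imports
    "HOL-Library.Poly_Mapping"
    "HOL-Computational_Algebra.Polynomial"
    "Jordan_Normal_Form.Matrix_Kernel"
begin

section \<open>The free algebra and its evaluations\<close>

text \<open>
  The free monoid on \<^typ>\<open>'g\<close>. With it, the convolution product of \<^theory>\<open>HOL-Library.Poly_Mapping\<close>
  makes the type \<open>'g list \<Rightarrow>\<^sub>0 'a\<close> the free associative unital algebra over \<open>'a\<close> on the finite set
  of variables \<open>'g\<close>; the number of variables is \<open>g = CARD('g)\<close>.
\<close>

instantiation list :: (type) monoid_add
begin

definition zero_list :: "'a list" where "zero_list = []"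

definition plus_list :: "'a list \<Rightarrow> 'a list \<Rightarrow> 'a list" where "plus_list = (@)"

instance by standard (simp_all add: zero_list_def plus_list_def)

end

type_synonym ('g, 'a) ncpoly = "'g list \<Rightarrow>\<^sub>0 'a"

definition const_term :: "('g, 'a::zero) ncpoly \<Rightarrow> 'a" where
  "const_term f = Poly_Mapping.lookup f []"

definition word_eval :: "nat \<Rightarrow> ('g \<Rightarrow> 'a::semiring_1 mat) \<Rightarrow> 'g list \<Rightarrow> 'a mat" where
  "word_eval n X w = foldr (\<lambda>j M. X j * M) w (1\<^sub>m n)"

definition mat_sum :: "nat \<Rightarrow> ('b \<Rightarrow> 'a::comm_monoid_add mat) \<Rightarrow> 'b set \<Rightarrow> 'a mat" where
  "mat_sum n M S = mat n n (\<lambda>ik. \<Sum>s\<in>S. M s $$ ik)"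

definition nc_eval :: "('g, 'a::semiring_1) ncpoly \<Rightarrow> nat \<Rightarrow> ('g \<Rightarrow> 'a mat) \<Rightarrow> 'a mat" where
  "nc_eval f n X =
     mat_sum n (\<lambda>w. Poly_Mapping.lookup f w \<cdot>\<^sub>m word_eval n X w) (Poly_Mapping.keys f)"


section \<open>Monic pencils\<close>

definition kronecker :: "'a::times mat \<Rightarrow> 'a mat \<Rightarrow> 'a mat" where
  "kronecker A B = mat (dim_row A * dim_row B) (dim_col A * dim_col B)
     (\<lambda>(i, k). A $$ (i div dim_row B, k div dim_col B) * B $$ (i mod dim_row B, k mod dim_col B))"

text \<open>
  The monic pencil \<open>L = I\<^sub>d - (\<Sum>j. A\<^sub>j x\<^sub>j)\<close> is represented by its size \<open>d\<close> and its coefficients \<open>A\<close>.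
\<close>

definition monic_pencil :: "nat \<Rightarrow> ('g \<Rightarrow> 'a mat) \<Rightarrow> bool" where
  "monic_pencil d A \<longleftrightarrow> d \<ge> 1 \<and> (\<forall>j. A j \<in> carrier_mat d d)"

definition pencil_eval ::
    "nat \<Rightarrow> ('g::finite \<Rightarrow> 'a::comm_ring_1 mat) \<Rightarrow> nat \<Rightarrow> ('g \<Rightarrow> 'a mat) \<Rightarrow> 'a mat" where
  "pencil_eval d A n X = 1\<^sub>m (d * n) - mat_sum (d * n) (\<lambda>j. kronecker (A j) (X j)) UNIV"

definition jointly_nilpotent :: "nat \<Rightarrow> ('g \<Rightarrow> 'a::semiring_1 mat) \<Rightarrow> bool" where
  "jointly_nilpotent d N \<longleftrightarrow> (\<exists>m. \<forall>w. length w = m \<longrightarrow> word_eval d N w = 0\<^sub>m d d)"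

definition codim :: "nat \<Rightarrow> 'a::field vec set \<Rightarrow> nat" where
  "codim d W = d - vectorspace.dim class_ring (module_vec TYPE('a) d\<lparr>carrier := W\<rparr>)"

definition flip_poly :: "nat \<Rightarrow> ('g \<Rightarrow> 'a::field mat) \<Rightarrow> bool" where
  "flip_poly d A \<longleftrightarrow> monic_pencil d A \<and>
     (\<exists>N E. (\<forall>j. N j \<in> carrier_mat d d \<and> E j \<in> carrier_mat d d \<and> A j = N j + E j) \<and>
            jointly_nilpotent d N \<and> codim d (\<Inter>j. mat_kernel (E j)) \<le> 1)"


section \<open>Free loci\<close>

text \<open>
  The argument \<open>h\<close> is an evaluation map, \<^term>\<open>nc_eval f\<close> or \<^term>\<open>pencil_eval d A\<close>. As \<open>'g\<close> is
  nonempty, a tuple determines the size of its matrices, so the union over \<open>n\<close> is disjoint.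
  The size \<open>n = 0\<close> contributes nothing, since the determinant of the empty matrix is \<open>1\<close>.
\<close>

definition free_locus ::
    "(nat \<Rightarrow> ('g \<Rightarrow> 'a::comm_ring_1 mat) \<Rightarrow> 'a mat) \<Rightarrow> ('g \<Rightarrow> 'a mat) set" where
  "free_locus h = (\<Union>n. {X. (\<forall>j. X j \<in> carrier_mat n n) \<and> det (h n X) = 0})"

text \<open>
  The origin never lies on the free locus of a monic pencil, and lies on the free locus of \<open>f\<close> as
  soon as \<open>f(0) = 0\<close>. Hence only polynomials with nonzero constant term can share their
  free locus with a monic pencil.
\<close>

lemma origin_in_free_locus_nc_eval:
  fixes f :: "('g, 'a::comm_ring_1) ncpoly"
  assumes "const_term f = 0"
  shows "(\<lambda>_. 0\<^sub>m 1 1) \<in> free_locus (nc_eval f)"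
proof -
  have car: "word_eval 1 (\<lambda>_::'g. 0\<^sub>m 1 1 :: 'a mat) w \<in> carrier_mat 1 1" for w
    unfolding word_eval_def by (induction w) (auto simp del: One_nat_def intro!: mult_carrier_mat)
  have w0: "word_eval 1 (\<lambda>_::'g. 0\<^sub>m 1 1 :: 'a mat) w = 0\<^sub>m 1 1" if "w \<noteq> []" for w
  proof (cases w)
    case (Cons j v)
    have "word_eval 1 (\<lambda>_::'g. 0\<^sub>m 1 1 :: 'a mat) w = 0\<^sub>m 1 1 * word_eval 1 (\<lambda>_. 0\<^sub>m 1 1) v"
      by (simp add: word_eval_def Cons)
    then show ?thesis using left_mult_zero_mat[OF car] by simp
  qed (use that in simp)
  have nil: "[] \<notin> Poly_Mapping.keys f"
    using assms by (simp add: const_term_def in_keys_iff)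
  have "nc_eval f 1 (\<lambda>_. 0\<^sub>m 1 1) = 0\<^sub>m 1 1"
  proof (rule eq_matI)
    fix i k assume "i < dim_row (0\<^sub>m 1 1 :: 'a mat)" "k < dim_col (0\<^sub>m 1 1 :: 'a mat)"
    then have ik: "i = 0" "k = 0" by auto
    have "(\<Sum>w\<in>Poly_Mapping.keys f.
        (Poly_Mapping.lookup f w \<cdot>\<^sub>m word_eval 1 (\<lambda>_::'g. 0\<^sub>m 1 1) w) $$ (0, 0)) = 0"
      using nil by (intro sum.neutral ballI) (metis index_zero_mat(1) less_one smult_zero_mat w0)
    then show "nc_eval f 1 (\<lambda>_. 0\<^sub>m 1 1) $$ (i, k) = 0\<^sub>m 1 1 $$ (i, k)"
      by (simp add: nc_eval_def mat_sum_def ik)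
  qed (simp_all add: nc_eval_def mat_sum_def)
  then have "det (nc_eval f 1 (\<lambda>_. 0\<^sub>m 1 1)) = 0"
    by (simp add: det_single)
  then show ?thesis
    unfolding free_locus_def by (intro UN_I[of 1]) simp_all
qed

lemma origin_notin_free_locus_pencil_eval:
  fixes A :: "'g::finite \<Rightarrow> 'a::comm_ring_1 mat"
  assumes "monic_pencil d A"
  shows "(\<lambda>_. 0\<^sub>m 1 1) \<notin> free_locus (pencil_eval d A)"
proof
  assume "(\<lambda>_. 0\<^sub>m 1 1) \<in> free_locus (pencil_eval d A)"
  then obtain n where n: "(0\<^sub>m 1 1 :: 'a mat) \<in> carrier_mat n n"
    and det0: "det (pencil_eval d A n (\<lambda>_. 0\<^sub>m 1 1)) = 0"
    unfolding free_locus_def by auto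
  then have n1: "n = 1" by auto
  have dim: "dim_row (A j) = d" "dim_col (A j) = d" for j
    using assms by (auto simp: monic_pencil_def)
  have "pencil_eval d A 1 (\<lambda>_. 0\<^sub>m 1 1) = 1\<^sub>m d"
    by (rule eq_matI) (auto simp: pencil_eval_def mat_sum_def kronecker_def dim)
  then show False using det0 n1 by simp
qed

end

theory Submission
  imports Defs
begin

text \<open>
  A pencil \<open>L = I - (\<Sum>j. (N\<^sub>j + e\<^sub>j u) x\<^sub>j)\<close> with \<open>N\<close> jointly nilpotent, column vectors \<open>e\<^sub>j\<close> and a single
  row vector \<open>u\<close> factors as \<open>L = L\<^sub>N (I - L\<^sub>N\<inverse> e u)\<close>, where \<open>L\<^sub>N = I - (\<Sum>j. N\<^sub>j x\<^sub>j)\<close> has the polynomial inverse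
  \<open>\<Sum>w. N\<^sup>w w\<close> and \<open>e = (\<Sum>j. e\<^sub>j x\<^sub>j)\<close>. By Sylvester's determinant identity, \<open>det L(X)\<close> vanishes
  exactly when \<open>det f(X)\<close> does, for the polynomial \<open>f = 1 - u L\<^sub>N\<inverse> e\<close>, whose coefficient at
  \<open>w x\<^sub>j\<close> is \<open>- u N\<^sup>w e\<^sub>j\<close>. The codimension condition says precisely that \<open>E\<^sub>j = e\<^sub>j u\<close> for a common \<open>u\<close>;
  conversely, every polynomial with constant term \<open>1\<close> has such coefficients, with \<open>N\<^sub>j\<close> the shift
  \<open>w \<mapsto> w x\<^sub>j\<close> on words of bounded length.
\<close>

section \<open>Sums and Kronecker products of matrices\<close>

text \<open>Rectangular version of \<open>mat_sum\<close>: the column part of the pencil is a sum of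
  \<open>d * n\<close> by \<open>n\<close> matrices. Carrying the shape as arguments gives empty
  sums a definite size.\<close>

definition msum :: "nat \<Rightarrow> nat \<Rightarrow> ('b \<Rightarrow> 'a::comm_monoid_add mat) \<Rightarrow> 'b set \<Rightarrow> 'a mat" where
  "msum nr nc M S = mat nr nc (\<lambda>ik. \<Sum>s\<in>S. M s $$ ik)"

lemma mat_sum_eq_msum: "mat_sum n = msum n n"
  by (simp add: fun_eq_iff mat_sum_def msum_def)

lemma msum_carrier [simp]: "msum nr nc M S \<in> carrier_mat nr nc"
  and dim_row_msum [simp]: "dim_row (msum nr nc M S) = nr"
  and dim_col_msum [simp]: "dim_col (msum nr nc M S) = nc"
  by (simp_all add: msum_def)

lemma index_msum [simp]:
  "i < nr \<Longrightarrow> k < nc \<Longrightarrow> msum nr nc M S $$ (i, k) = (\<Sum>s\<in>S. M s $$ (i, k))"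
  by (simp add: msum_def)

lemma msum_cong: "(\<And>s. s \<in> S \<Longrightarrow> M s = M' s) \<Longrightarrow> msum nr nc M S = msum nr nc M' S"
  by (simp add: msum_def)

lemma msum_empty: "msum nr nc M {} = 0\<^sub>m nr nc"
  by (rule eq_matI) auto

lemma msum_single: "M s \<in> carrier_mat nr nc \<Longrightarrow> msum nr nc M {s} = M s"
  by (rule eq_matI) auto

lemma msum_zero: "(\<And>s. s \<in> S \<Longrightarrow> M s = 0\<^sub>m nr nc) \<Longrightarrow> msum nr nc M S = 0\<^sub>m nr nc"
  by (rule eq_matI) auto

lemma msum_union_disjoint:
  "finite S \<Longrightarrow> finite T \<Longrightarrow> S \<inter> T = {} \<Longrightarrow>
    msum nr nc M (S \<union> T) = msum nr nc M S + msum nr nc M T"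
  by (rule eq_matI) (auto simp: sum.union_disjoint)

lemma msum_add:
  assumes "\<And>s. s \<in> S \<Longrightarrow> M s \<in> carrier_mat nr nc" "\<And>s. s \<in> S \<Longrightarrow> M' s \<in> carrier_mat nr nc"
  shows "msum nr nc (\<lambda>s. M s + M' s) S = msum nr nc M S + msum nr nc M' S"
proof (rule eq_matI)
  fix i k assume ik: "i < dim_row (msum nr nc M S + msum nr nc M' S)"
    "k < dim_col (msum nr nc M S + msum nr nc M' S)"
  have "(M s + M' s) $$ (i, k) = M s $$ (i, k) + M' s $$ (i, k)" if "s \<in> S" for s
    using assms[OF that] ik by (intro index_add_mat) auto
  with ik show "msum nr nc (\<lambda>s. M s + M' s) S $$ (i, k) = (msum nr nc M S + msum nr nc M' S) $$ (i, k)"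
    by (simp add: sum.distrib)
qed auto

lemma msum_reindex: "inj_on f S \<Longrightarrow> msum nr nc M (f ` S) = msum nr nc (\<lambda>s. M (f s)) S"
  by (simp add: msum_def sum.reindex)

lemma msum_msum:
  "msum nr nc (\<lambda>s. msum nr nc (M s) T) S = msum nr nc (\<lambda>(s, t). M s t) (S \<times> T)"
  by (rule eq_matI) (auto simp: sum.cartesian_product intro!: sum.cong)

lemma index_mult_mat_sum:
  fixes A :: "'a::semiring_0 mat"
  assumes "A \<in> carrier_mat m l" "B \<in> carrier_mat l n" "i < m" "k < n"
  shows "(A * B) $$ (i, k) = (\<Sum>r<l. A $$ (i, r) * B $$ (r, k))"
  using assms by (auto simp: scalar_prod_def lessThan_atLeast0)

lemma mult_msum:
  fixes A :: "'a::semiring_0 mat"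
  assumes "A \<in> carrier_mat m nr" "\<And>s. s \<in> S \<Longrightarrow> M s \<in> carrier_mat nr nc"
  shows "A * msum nr nc M S = msum m nc (\<lambda>s. A * M s) S"
proof (rule eq_matI)
  fix i k assume "i < dim_row (msum m nc (\<lambda>s. A * M s) S)" "k < dim_col (msum m nc (\<lambda>s. A * M s) S)"
  then have ik: "i < m" "k < nc" by auto
  have "(\<Sum>s\<in>S. (A * M s) $$ (i, k)) = (\<Sum>s\<in>S. \<Sum>l<nr. A $$ (i, l) * M s $$ (l, k))"
    using assms ik by (intro sum.cong index_mult_mat_sum) auto
  also have "\<dots> = (\<Sum>l<nr. A $$ (i, l) * (\<Sum>s\<in>S. M s $$ (l, k)))"
    by (subst sum.swap) (simp add: sum_distrib_left)
  finally show "(A * msum nr nc M S) $$ (i, k) = msum m nc (\<lambda>s. A * M s) S $$ (i, k)"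
    using ik by (simp add: index_mult_mat_sum[OF assms(1) msum_carrier])
qed (use assms in auto)

lemma msum_mult:
  fixes A :: "'a::semiring_0 mat"
  assumes "A \<in> carrier_mat nc m" "\<And>s. s \<in> S \<Longrightarrow> M s \<in> carrier_mat nr nc"
  shows "msum nr nc M S * A = msum nr m (\<lambda>s. M s * A) S"
proof (rule eq_matI)
  fix i k assume "i < dim_row (msum nr m (\<lambda>s. M s * A) S)" "k < dim_col (msum nr m (\<lambda>s. M s * A) S)"
  then have ik: "i < nr" "k < m" by auto
  have "(\<Sum>s\<in>S. (M s * A) $$ (i, k)) = (\<Sum>s\<in>S. \<Sum>l<nc. M s $$ (i, l) * A $$ (l, k))"
    using assms ik by (intro sum.cong index_mult_mat_sum) auto
  also have "\<dots> = (\<Sum>l<nc. (\<Sum>s\<in>S. M s $$ (i, l)) * A $$ (l, k))"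
    by (subst sum.swap) (simp add: sum_distrib_right)
  finally show "(msum nr nc M S * A) $$ (i, k) = msum nr m (\<lambda>s. M s * A) S $$ (i, k)"
    using ik by (simp add: index_mult_mat_sum[OF msum_carrier assms(1)])
qed (use assms in auto)

section \<open>Kronecker products and the mixed-product rule\<close>

lemma kronecker_carrier [simp]:
  "A \<in> carrier_mat a b \<Longrightarrow> B \<in> carrier_mat p q \<Longrightarrow> kronecker A B \<in> carrier_mat (a * p) (b * q)"
  by (auto simp: kronecker_def)

lemma index_kronecker:
  assumes "A \<in> carrier_mat a b" "B \<in> carrier_mat p q" "i < a * p" "k < b * q"
  shows "kronecker A B $$ (i, k) = A $$ (i div p, k div q) * B $$ (i mod p, k mod q)"
  using assms by (auto simp: kronecker_def)

lemma div_mod_less: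
  assumes "i < a * (p::nat)"
  shows "i div p < a" "i mod p < p"
proof -
  have "0 < p" using assms by (cases p) auto
  then show "i div p < a" "i mod p < p"
    using assms by (auto simp: less_mult_imp_div_less)
qed

text \<open>Division with remainder by \<open>q\<close> matches the indices below
  \<open>b * q\<close> with pairs \<open>(x, y)\<close>, with inverse \<open>x * q + y\<close>. This
  splits the index of a Kronecker product into its two factors.\<close>

lemma sum_div_mod:
  fixes q :: nat
  shows "(\<Sum>l<b * q. f (l div q) (l mod q)) = (\<Sum>x<b. \<Sum>y<q. f x y)"
proof -
  have "x * q + y < b * q" if "x < b" "y < q" for x y
  proof -
    have "x * q + y < Suc x * q" using that by simp
    also have "\<dots> \<le> b * q" using that by (intro mult_right_mono) auto
    finally show ?thesis .
  qed
  then show ?thesis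
    unfolding sum.cartesian_product
    by (intro sum.reindex_bij_witness[of _ "\<lambda>(x, y). x * q + y" "\<lambda>l. (l div q, l mod q)"])
      (auto simp: div_mod_less)
qed

text \<open>Splitting the summation index into quotient and remainder makes the double sum a product
  of two sums, once commutativity of the scalars brings the entries of \<open>A\<close> and
  \<open>C\<close> together.\<close>

lemma kronecker_mult:
  fixes A :: "'a::comm_semiring_0 mat"
  assumes A: "A \<in> carrier_mat a b" and B: "B \<in> carrier_mat p q"
    and C: "C \<in> carrier_mat b c" and D: "D \<in> carrier_mat q r"
  shows "kronecker A B * kronecker C D = kronecker (A * C) (B * D)"
proof (rule eq_matI)
  have AC: "A * C \<in> carrier_mat a c" and BD: "B * D \<in> carrier_mat p r"
    using assms by auto
  note carr = kronecker_carrier[OF A B] kronecker_carrier[OF C D] kronecker_carrier[OF AC BD]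
  fix i k assume "i < dim_row (kronecker (A * C) (B * D))" "k < dim_col (kronecker (A * C) (B * D))"
  then have ik: "i < a * p" "k < c * r" using carr by auto
  note bounds = div_mod_less[OF ik(1)] div_mod_less[OF ik(2)]
  have "(kronecker A B * kronecker C D) $$ (i, k)
      = (\<Sum>l<b * q. kronecker A B $$ (i, l) * kronecker C D $$ (l, k))"
    by (rule index_mult_mat_sum[OF carr(1,2) ik])
  also have "\<dots> = (\<Sum>l<b * q. (\<lambda>x y. (A $$ (i div p, x) * B $$ (i mod p, y))
                  * (C $$ (x, k div r) * D $$ (y, k mod r))) (l div q) (l mod q))"
    using ik by (intro sum.cong) (auto simp: index_kronecker[OF A B] index_kronecker[OF C D])
  also have "\<dots> = (\<Sum>x<b. A $$ (i div p, x) * C $$ (x, k div r)) * (\<Sum>y<q. B $$ (i mod p, y) * D $$ (y, k mod r))"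
    by (subst sum_div_mod) (simp add: sum_product algebra_simps)
  also have "\<dots> = (A * C) $$ (i div p, k div r) * (B * D) $$ (i mod p, k mod r)"
    using bounds by (simp add: index_mult_mat_sum[OF A C] index_mult_mat_sum[OF B D])
  also have "\<dots> = kronecker (A * C) (B * D) $$ (i, k)"
    using index_kronecker[OF AC BD ik] by simp
  finally show "(kronecker A B * kronecker C D) $$ (i, k) = kronecker (A * C) (B * D) $$ (i, k)" .
qed (use assms in \<open>auto simp: kronecker_def\<close>)

lemma kronecker_one: "kronecker (1\<^sub>m d) (1\<^sub>m n) = (1\<^sub>m (d * n) :: 'a::semiring_1 mat)"
proof (rule eq_matI)
  fix i k assume "i < dim_row (1\<^sub>m (d * n) :: 'a mat)" "k < dim_col (1\<^sub>m (d * n) :: 'a mat)"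
  then have ik: "i < d * n" "k < d * n" by auto
  have "i = k \<longleftrightarrow> i div n = k div n \<and> i mod n = k mod n"
    by (metis div_mult_mod_eq)
  with ik div_mod_less[OF ik(1)] div_mod_less[OF ik(2)]
  show "kronecker (1\<^sub>m d) (1\<^sub>m n) $$ (i, k) = (1\<^sub>m (d * n) :: 'a mat) $$ (i, k)"
    by (auto simp: index_kronecker[where a = d and b = d and p = n and q = n])
qed (auto simp: kronecker_def)

lemma kronecker_zero_left:
  "B \<in> carrier_mat p q \<Longrightarrow> kronecker (0\<^sub>m a b) B = (0\<^sub>m (a * p) (b * q) :: 'a::mult_zero mat)"
  by (rule eq_matI) (auto simp: kronecker_def div_mod_less)

lemma kronecker_add_left:
  fixes A :: "'a::semiring mat"
  assumes A: "A \<in> carrier_mat a b" "A' \<in> carrier_mat a b" and B: "B \<in> carrier_mat p q"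
  shows "kronecker (A + A') B = kronecker A B + kronecker A' B"
proof (rule eq_matI)
  fix i k assume "i < dim_row (kronecker A B + kronecker A' B)"
    "k < dim_col (kronecker A B + kronecker A' B)"
  then have ik: "i < a * p" "k < b * q" using assms by (auto simp: kronecker_def)
  show "kronecker (A + A') B $$ (i, k) = (kronecker A B + kronecker A' B) $$ (i, k)"
    using assms div_mod_less[OF ik(1)] div_mod_less[OF ik(2)] ik
    by (subst index_add_mat) (auto simp: kronecker_def algebra_simps)
qed (use assms in \<open>auto simp: kronecker_def\<close>)

lemma kronecker_one_by_one:
  assumes "A \<in> carrier_mat 1 1" "B \<in> carrier_mat p q"
  shows "kronecker A B = A $$ (0, 0) \<cdot>\<^sub>m B"
  using assms by (intro eq_matI) (auto simp: kronecker_def)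

text \<open>Sylvester's identity. The block matrix \<open>M\<close> with rows \<open>(1, A)\<close>
  and \<open>(B, 1)\<close> is reduced by the unitriangular \<open>P\<close> and \<open>Q\<close>,
  both of determinant 1, to block triangular form. Either way \<open>det M\<close> is the
  determinant of a Schur complement, \<open>1 - A * B\<close> or \<open>1 - B * A\<close>.\<close>

lemma det_one_minus_mult_commute:
  fixes A :: "'a::idom mat"
  assumes A: "A \<in> carrier_mat m n" and B: "B \<in> carrier_mat n m"
  shows "det (1\<^sub>m m - A * B) = det (1\<^sub>m n - B * A)"
proof -
  define M where "M = four_block_mat (1\<^sub>m m) A B (1\<^sub>m n)"
  define P where "P = four_block_mat (1\<^sub>m m) (- A) (0\<^sub>m n m) (1\<^sub>m n)"
  define Q where "Q = four_block_mat (1\<^sub>m m) (0\<^sub>m m n) (- B) (1\<^sub>m n)"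
  have carr: "M \<in> carrier_mat (m + n) (m + n)" "P \<in> carrier_mat (m + n) (m + n)"
    "Q \<in> carrier_mat (m + n) (m + n)"
    by (auto simp: M_def P_def Q_def)
  have detPQ: "det P = 1" "det Q = 1"
    using A B unfolding P_def Q_def
    by (subst det_four_block_mat_lower_left_zero[where n = m and m = n]
        det_four_block_mat_upper_right_zero[where n = m and m = n]; simp)+
  have "P * M = four_block_mat (1\<^sub>m m - A * B) (0\<^sub>m m n) B (1\<^sub>m n)"
    using A B unfolding P_def M_def
    by (subst mult_four_block_mat[where ?n1.0 = m and ?n2.0 = n])
      (auto intro!: arg_cong4[of _ _ _ _ _ _ _ _ four_block_mat] eq_matI)
  then have "det (P * M) = det (1\<^sub>m m - A * B)"
    using minus_carrier_mat[OF mult_carrier_mat[OF A B]] B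
    by (simp add: det_four_block_mat_upper_right_zero[where n = m and m = n])
  moreover have "Q * M = four_block_mat (1\<^sub>m m) A (0\<^sub>m n m) (1\<^sub>m n - B * A)"
    using A B unfolding Q_def M_def
    by (subst mult_four_block_mat[where ?n1.0 = m and ?n2.0 = n])
      (auto intro!: arg_cong4[of _ _ _ _ _ _ _ _ four_block_mat] eq_matI)
  then have "det (Q * M) = det (1\<^sub>m n - B * A)"
    using minus_carrier_mat[OF mult_carrier_mat[OF B A]] A
    by (simp add: det_four_block_mat_lower_left_zero[where n = m and m = n])
  ultimately show ?thesis
    using carr detPQ by (simp add: det_mult[where n = "m + n"])
qed

section \<open>Determinants of rank-one perturbations of nilpotent pencils\<close>

lemma word_eval_Nil: "word_eval n X [] = 1\<^sub>m n"
  and word_eval_Cons: "word_eval n X (j # w) = X j * word_eval n X w"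
  by (simp_all add: word_eval_def)

lemma word_eval_carrier:
  "(\<And>j. X j \<in> carrier_mat n n) \<Longrightarrow> word_eval n X w \<in> carrier_mat n n"
  by (induction w) (auto simp: word_eval_Nil word_eval_Cons intro!: mult_carrier_mat)

lemma pencil_eval_carrier [simp]: "pencil_eval d A n X \<in> carrier_mat (d * n) (d * n)"
  unfolding pencil_eval_def mat_sum_eq_msum by (intro minus_carrier_mat msum_carrier)

text \<open>Joint nilpotency speaks of words of length exactly \<open>m\<close>; a longer word has
  such a word as a suffix, reached by removing letters from the front.\<close>

lemma word_eval_eq_0_if_length_ge:
  assumes N: "\<And>j. N j \<in> carrier_mat d d" and m: "\<And>w. length w = m \<Longrightarrow> word_eval d N w = 0\<^sub>m d d"
    and "m \<le> length w"
  shows "word_eval d N w = 0\<^sub>m d d"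
  using assms(3)
proof (induction w)
  case (Cons i w)
  show ?case
  proof (cases "length (i # w) = m")
    case False
    with Cons N[of i] show ?thesis by (simp add: word_eval_Cons)
  qed (rule m)
qed (use m in auto)

text \<open>\<open>word_eval\<close> unfolds at the first letter, whereas the coefficients of the
  polynomial below are indexed by the last letter.\<close>

lemma word_eval_snoc:
  assumes "\<And>j. X j \<in> carrier_mat n n"
  shows "word_eval n X (w @ [j]) = word_eval n X w * X j"
proof (induction w)
  case Nil
  then show ?case using assms[of j] by (simp add: word_eval_Nil word_eval_Cons)
next
  case (Cons i w)
  then show ?case
    using assms[of j] assms[of i] word_eval_carrier[of X n w, OF assms]
    by (simp add: word_eval_Cons assoc_mult_mat[where n\<^sub>1 = n])
qed

lemma finite_words_length_less: "finite {w :: 'g::finite list. length w < m}"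
  using finite_lists_length_le[of "UNIV :: 'g set" m]
  by (rule rev_finite_subset) auto

lemma finite_words_length_eq: "finite {w :: 'g::finite list. length w = m}"
  using finite_words_length_less[of "Suc m"] by (rule rev_finite_subset) auto

section \<open>The polynomial inverse of a jointly nilpotent pencil\<close>

context
  fixes d n :: nat and N X :: "'g::finite \<Rightarrow> 'a::comm_ring_1 mat"
  assumes N: "\<And>j. N j \<in> carrier_mat d d" and X: "\<And>j. X j \<in> carrier_mat n n"
begin

lemma kronecker_word_carrier:
  "kronecker (word_eval d N w) (word_eval n X w) \<in> carrier_mat (d * n) (d * n)"
  by (intro kronecker_carrier word_eval_carrier N X)

text \<open>By the mixed-product rule, multiplying by the summand of letter \<open>j\<close>
  prepends \<open>j\<close> to a word, and every word of length \<open>Suc k\<close> arises exactly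
  once. The homogeneous sums are thus the powers of the linear part.\<close>

lemma linear_part_mult_homogeneous:
  "msum (d * n) (d * n) (\<lambda>j. kronecker (N j) (X j)) UNIV *
     msum (d * n) (d * n) (\<lambda>w. kronecker (word_eval d N w) (word_eval n X w)) {w. length w = k}
   = msum (d * n) (d * n) (\<lambda>w. kronecker (word_eval d N w) (word_eval n X w)) {w. length w = Suc k}"
    (is "?T * ?W k = ?W (Suc k)")
proof -
  let ?K = "\<lambda>w. kronecker (word_eval d N w) (word_eval n X w)"
  have K: "kronecker (N j) (X j) \<in> carrier_mat (d * n) (d * n)" for j
    by (intro kronecker_carrier N X)
  have step: "kronecker (N j) (X j) * ?K w = ?K (j # w)" for j w
    using N[of j] X[of j]
    by (simp add: kronecker_mult[OF _ _ word_eval_carrier[OF N] word_eval_carrier[OF X]] word_eval_Cons)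
  have "?T * ?W k = msum (d * n) (d * n) (\<lambda>j. kronecker (N j) (X j) * ?W k) UNIV"
    by (rule msum_mult[OF msum_carrier K])
  also have "\<dots> = msum (d * n) (d * n) (\<lambda>j. msum (d * n) (d * n) (\<lambda>w. ?K (j # w)) {w. length w = k}) UNIV"
    by (simp add: mult_msum[OF K kronecker_word_carrier] step)
  also have "\<dots> = msum (d * n) (d * n) (\<lambda>p. ?K (case p of (j, w) \<Rightarrow> j # w)) (UNIV \<times> {w. length w = k})"
    by (simp add: msum_msum case_prod_unfold)
  also have "\<dots> = msum (d * n) (d * n) ?K ((\<lambda>(j, w). j # w) ` (UNIV \<times> {w. length w = k}))"
    by (rule msum_reindex[symmetric]) (auto simp: inj_on_def)
  also have "(\<lambda>(j, w). j # w) ` (UNIV \<times> {w. length w = k}) = {w :: 'g list. length w = Suc k}"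
    by (auto simp: length_Suc_conv image_iff)
  finally show ?thesis .
qed

text \<open>The telescoping geometric series
  \<open>(1 - T) * (1 + T + ... + T^(m-1)) = 1 - T^m\<close>, with the power \<open>T^k\<close>
  written as the sum over words of length \<open>k\<close>.\<close>

lemma pencil_eval_mult_truncated_inverse:
  "pencil_eval d N n X *
     msum (d * n) (d * n) (\<lambda>w. kronecker (word_eval d N w) (word_eval n X w)) {w. length w < m}
   = 1\<^sub>m (d * n) -
     msum (d * n) (d * n) (\<lambda>w. kronecker (word_eval d N w) (word_eval n X w)) {w. length w = m}"
proof (induction m)
  let ?K = "\<lambda>w. kronecker (word_eval d N w) (word_eval n X w)"
  case 0
  have "{w :: 'g list. length w = 0} = {[]}" by auto
  moreover have "?K [] = 1\<^sub>m (d * n)"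
    by (simp add: word_eval_Nil kronecker_one)
  ultimately have "msum (d * n) (d * n) ?K {w. length w = 0} = 1\<^sub>m (d * n)"
    by (simp add: msum_single)
  then show ?case
    by (auto simp: msum_empty pencil_eval_def mat_sum_eq_msum)
next
  let ?K = "\<lambda>w. kronecker (word_eval d N w) (word_eval n X w)"
  let ?W = "\<lambda>k. msum (d * n) (d * n) ?K {w. length w = k}"
  let ?T = "msum (d * n) (d * n) (\<lambda>j. kronecker (N j) (X j)) UNIV"
  let ?L = "pencil_eval d N n X"
  have L: "?L \<in> carrier_mat (d * n) (d * n)" "?L = 1\<^sub>m (d * n) - ?T"
    by simp (simp add: pencil_eval_def mat_sum_eq_msum)
  case (Suc m)
  have "{w :: 'g list. length w < Suc m} = {w. length w < m} \<union> {w. length w = m}" by auto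
  then have "msum (d * n) (d * n) ?K {w. length w < Suc m} =
      msum (d * n) (d * n) ?K {w. length w < m} + ?W m"
    using finite_words_length_less finite_words_length_eq
    by (auto intro!: msum_union_disjoint)
  then have "?L * msum (d * n) (d * n) ?K {w. length w < Suc m} = (1\<^sub>m (d * n) - ?W m) + ?L * ?W m"
    using Suc L(1) by (simp add: mult_add_distrib_mat[where nr = "d * n" and n = "d * n" and nc = "d * n"])
  also have "?L * ?W m = ?W m - ?W (Suc m)"
    unfolding L(2) linear_part_mult_homogeneous[symmetric]
    by (subst minus_mult_distrib_mat[where nr = "d * n" and n = "d * n" and nc = "d * n"]) auto
  also have "(1\<^sub>m (d * n) - ?W m) + (?W m - ?W (Suc m)) = 1\<^sub>m (d * n) - ?W (Suc m)"
    by (rule eq_matI) auto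
  finally show ?case .
qed

end

text \<open>The coefficient hypotheses say that \<open>f\<close> is \<open>c\<close> times
  \<open>1 - u L^(-1) e\<close>, where \<open>L\<close> is the pencil of \<open>N\<close>. A general
  \<open>c\<close> serves both inclusions: \<open>c = 1\<close> when \<open>f\<close> is built from
  a pencil, and the constant term of \<open>f\<close> when a pencil is built from
  \<open>f\<close>.\<close>

theorem det_pencil_eval_rank_one_perturbation:
  fixes N X e :: "'g::finite \<Rightarrow> 'a::field mat" and f :: "('g, 'a) ncpoly"
  assumes N: "\<And>j. N j \<in> carrier_mat d d" and X: "\<And>j. X j \<in> carrier_mat n n"
    and nil: "jointly_nilpotent d N"
    and u: "u \<in> carrier_mat 1 d" and e: "\<And>j. e j \<in> carrier_mat d 1"
    and c: "c \<noteq> 0" "Poly_Mapping.lookup f [] = c"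
    and f: "\<And>w j. Poly_Mapping.lookup f (w @ [j]) = - c * (u * word_eval d N w * e j) $$ (0, 0)"
  shows "det (pencil_eval d (\<lambda>j. N j + e j * u) n X) = 0 \<longleftrightarrow> det (nc_eval f n X) = 0"
proof -
  obtain m where m: "\<And>w. length w = m \<Longrightarrow> word_eval d N w = 0\<^sub>m d d"
    using nil unfolding jointly_nilpotent_def by blast
  let ?dn = "d * n"
  let ?K = "\<lambda>w. kronecker (word_eval d N w) (word_eval n X w)"
  let ?S = "{w :: 'g list. length w < m}"
  \<comment> \<open>At \<open>X\<close>: \<open>L\<close> is the nilpotent pencil, \<open>G\<close>
    its truncated geometric series, and \<open>F\<close> and \<open>U\<close> are the column part
    and the row part of the perturbation.\<close>
  define L where "L = pencil_eval d N n X"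
  define G where "G = msum ?dn ?dn ?K ?S"
  define F where "F = msum ?dn n (\<lambda>j. kronecker (e j) (X j)) UNIV"
  define U where "U = kronecker u (1\<^sub>m n)"
  have L: "L \<in> carrier_mat ?dn ?dn" and G: "G \<in> carrier_mat ?dn ?dn"
    and F: "F \<in> carrier_mat ?dn n"
    by (simp_all add: L_def G_def F_def)
  have U: "U \<in> carrier_mat n ?dn"
    using kronecker_carrier[OF u one_carrier_mat[of n]] by (simp add: U_def)
  have KF: "kronecker (e j) (X j) \<in> carrier_mat ?dn n" for j
    using kronecker_carrier[OF e[of j] X[of j]] by simp
  have "msum ?dn ?dn ?K {w. length w = m} = 0\<^sub>m ?dn ?dn"
    using m kronecker_zero_left[OF word_eval_carrier[of X n, OF X]] by (intro msum_zero) auto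
  then have LG: "L * G = 1\<^sub>m ?dn"
    using pencil_eval_mult_truncated_inverse[of N d X n m, OF N X] by (auto simp: L_def G_def)
  have pencil: "pencil_eval d (\<lambda>j. N j + e j * u) n X = L - F * U"
  proof -
    have KU: "kronecker (e j) (X j) * U = kronecker (e j * u) (X j)" for j
      unfolding U_def using kronecker_mult[OF e X u one_carrier_mat] X[of j] by simp
    have "F * U = msum ?dn ?dn (\<lambda>j. kronecker (e j * u) (X j)) UNIV"
      unfolding F_def using U KF by (simp add: msum_mult KU)
    moreover have "msum ?dn ?dn (\<lambda>j. kronecker (N j + e j * u) (X j)) UNIV
      = msum ?dn ?dn (\<lambda>j. kronecker (N j) (X j)) UNIV + msum ?dn ?dn (\<lambda>j. kronecker (e j * u) (X j)) UNIV"
    proof (subst msum_add[symmetric])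
      have eu: "e j * u \<in> carrier_mat d d" for j
        using e[of j] u by simp
      show "kronecker (N j) (X j) \<in> carrier_mat ?dn ?dn"
        "kronecker (e j * u) (X j) \<in> carrier_mat ?dn ?dn" for j
        by (intro kronecker_carrier N eu X)+
      show "msum ?dn ?dn (\<lambda>j. kronecker (N j + e j * u) (X j)) UNIV
        = msum ?dn ?dn (\<lambda>j. kronecker (N j) (X j) + kronecker (e j * u) (X j)) UNIV"
        by (intro msum_cong kronecker_add_left[OF N eu X])
    qed
    ultimately show ?thesis
      unfolding L_def pencil_eval_def mat_sum_eq_msum
      by (intro eq_matI) auto
  qed
  \<comment> \<open>Since \<open>L * G = 1\<close>, the factor \<open>L\<close> can be pulled out on
    the left; the same identity makes \<open>det L\<close> nonzero below.\<close>
  have "L - F * U = L * (1\<^sub>m ?dn - (G * F) * U)"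
  proof -
    have "L * (1\<^sub>m ?dn - (G * F) * U) = L * 1\<^sub>m ?dn - L * ((G * F) * U)"
      using L G F U by (intro mult_minus_distrib_mat[where nc = ?dn]) auto
    also have "L * ((G * F) * U) = (L * G) * (F * U)"
      using L G F U mult_carrier_mat[OF F U]
      by (simp add: assoc_mult_mat[OF G F U] assoc_mult_mat[OF L G, of "F * U" ?dn])
    finally show ?thesis using L F U by (simp add: LG)
  qed
  then have "det (L - F * U) = det L * det (1\<^sub>m ?dn - (G * F) * U)"
    using det_mult[OF L minus_carrier_mat[OF mult_carrier_mat[OF mult_carrier_mat[OF G F] U]]] by simp
  moreover have "det L \<noteq> 0"
    using det_mult[OF L G] LG by auto
  \<comment> \<open>Sylvester's identity passes from size \<open>d * n\<close> to size
    \<open>n\<close>, the size of the values of \<open>f\<close>.\<close>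
  moreover have "det (1\<^sub>m ?dn - (G * F) * U) = det (1\<^sub>m n - U * (G * F))"
    using G F U by (intro det_one_minus_mult_commute) auto
  ultimately have det: "det (L - F * U) = 0 \<longleftrightarrow> det (1\<^sub>m n - U * (G * F)) = 0"
    by simp

  define a where "a w j = (u * word_eval d N w * e j) $$ (0, 0)" for w j
  \<comment> \<open>The left Kronecker factor collapses to the 1 by 1 matrix with entry
    \<open>a w j\<close>, so only a scalar multiple of the word \<open>w @ [j]\<close> at
    \<open>X\<close> remains.\<close>
  have summand: "U * (?K w * kronecker (e j) (X j)) = a w j \<cdot>\<^sub>m word_eval n X (w @ [j])" for w j
  proof -
    have NW: "word_eval d N w \<in> carrier_mat d d" and XW: "word_eval n X w \<in> carrier_mat n n"
      using word_eval_carrier[of N d, OF N] word_eval_carrier[of X n, OF X] by auto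
    have "U * (?K w * kronecker (e j) (X j))
      = kronecker (u * (word_eval d N w * e j)) (1\<^sub>m n * (word_eval n X w * X j))"
      unfolding U_def using NW XW X[of j] e[of j] u
      by (subst kronecker_mult[OF NW XW e X], subst kronecker_mult) auto
    also have "\<dots> = kronecker (u * word_eval d N w * e j) (word_eval n X (w @ [j]))"
      using NW XW X[of j] e[of j] u word_eval_snoc[of X n w j, OF X]
      by (simp add: assoc_mult_mat[where n\<^sub>1 = 1])
    also have "\<dots> = a w j \<cdot>\<^sub>m word_eval n X (w @ [j])"
      unfolding a_def using u NW e[of j] word_eval_carrier[of X n, OF X]
      by (intro kronecker_one_by_one) auto
    finally show ?thesis .
  qed
  have KKF: "?K w * kronecker (e j) (X j) \<in> carrier_mat ?dn n" for w j
    using kronecker_word_carrier[of N d X n, OF N X] KF by (rule mult_carrier_mat)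
  have "G * F = msum ?dn n (\<lambda>w. ?K w * F) ?S"
    unfolding G_def using F kronecker_word_carrier[of N d X n, OF N X] by (rule msum_mult)
  also have "\<dots> = msum ?dn n (\<lambda>w. msum ?dn n (\<lambda>j. ?K w * kronecker (e j) (X j)) UNIV) ?S"
    unfolding F_def by (simp add: mult_msum[OF kronecker_word_carrier[of N d X n, OF N X] KF])
  also have "\<dots> = msum ?dn n (\<lambda>(w, j). ?K w * kronecker (e j) (X j)) (?S \<times> UNIV)"
    by (rule msum_msum)
  finally have "U * (G * F) = msum n n (\<lambda>p. U * (case p of (w, j) \<Rightarrow> ?K w * kronecker (e j) (X j))) (?S \<times> UNIV)"
    using KKF by (simp add: mult_msum[OF U] split: prod.split)
  also have "\<dots> = msum n n (\<lambda>(w, j). a w j \<cdot>\<^sub>m word_eval n X (w @ [j])) (?S \<times> UNIV)"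
    by (intro msum_cong) (auto simp: summand)
  finally have UGF: "U * (G * F) = msum n n (\<lambda>(w, j). a w j \<cdot>\<^sub>m word_eval n X (w @ [j])) (?S \<times> UNIV)" .

  have a0: "a w j = 0" if "m \<le> length w" for w j
    using word_eval_eq_0_if_length_ge[OF N m that] u e[of j] by (simp add: a_def)
  let ?J = "(\<lambda>(w, j). w @ [j]) ` (?S \<times> (UNIV :: 'g set))"
  have finJ: "finite ?J"
    by (intro finite_imageI finite_cartesian_product finite_words_length_less finite)
  \<comment> \<open>A nonempty word is \<open>w @ [j]\<close> for unique \<open>w\<close> and
    \<open>j\<close>, and its coefficient \<open>- c * a w j\<close> vanishes once \<open>w\<close>
    has length at least \<open>m\<close>. So the finite set \<open>?J\<close> together with the
    empty word contains the support of \<open>f\<close>.\<close>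
  have keys: "Poly_Mapping.keys f \<subseteq> insert [] ?J"
  proof
    fix v assume v: "v \<in> Poly_Mapping.keys f"
    show "v \<in> insert [] ?J"
    proof (cases v rule: rev_cases)
      case (snoc w j)
      have "a w j \<noteq> 0" using v f[of w j] by (auto simp: a_def snoc in_keys_iff)
      then have "length w < m" using a0[of w j] by force
      then show ?thesis using snoc by force
    qed simp
  qed
  \<comment> \<open>This gives \<open>det f(X) = c^n * det (1 - U * (G * F))\<close>, and
    \<open>c\<close> is nonzero.\<close>
  have "nc_eval f n X = c \<cdot>\<^sub>m (1\<^sub>m n - U * (G * F))"
  proof (rule eq_matI)
    fix i k assume "i < dim_row (c \<cdot>\<^sub>m (1\<^sub>m n - U * (G * F)))"
      "k < dim_col (c \<cdot>\<^sub>m (1\<^sub>m n - U * (G * F)))"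
    then have ik: "i < n" "k < n" by (auto simp: UGF)
    have we: "dim_row (word_eval n X w) = n" "dim_col (word_eval n X w) = n" for w
      using word_eval_carrier[of X n w, OF X] by auto
    have "nc_eval f n X $$ (i, k)
      = (\<Sum>w\<in>Poly_Mapping.keys f. Poly_Mapping.lookup f w * word_eval n X w $$ (i, k))"
      using ik by (simp add: nc_eval_def mat_sum_def we)
    also have "\<dots> = (\<Sum>w\<in>insert [] ?J. Poly_Mapping.lookup f w * word_eval n X w $$ (i, k))"
      using keys finJ by (intro sum.mono_neutral_left) (auto simp: in_keys_iff)
    also have "\<dots> = c * 1\<^sub>m n $$ (i, k) + (\<Sum>w\<in>?J. Poly_Mapping.lookup f w * word_eval n X w $$ (i, k))"
      using finJ by (subst sum.insert) (auto simp: c word_eval_Nil)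
    also have "(\<Sum>w\<in>?J. Poly_Mapping.lookup f w * word_eval n X w $$ (i, k))
      = (\<Sum>(w, j)\<in>?S \<times> UNIV. - c * (a w j * word_eval n X (w @ [j]) $$ (i, k)))"
      by (subst sum.reindex) (auto simp: inj_on_def f a_def intro!: sum.cong)
    also have "\<dots> = - c * (U * (G * F)) $$ (i, k)"
      using ik by (simp add: UGF sum_distrib_left case_prod_unfold we)
    also have "c * 1\<^sub>m n $$ (i, k) + - c * (U * (G * F)) $$ (i, k)
      = (c \<cdot>\<^sub>m (1\<^sub>m n - U * (G * F))) $$ (i, k)"
      using ik by (auto simp: UGF algebra_simps)
    finally show "nc_eval f n X $$ (i, k) = (c \<cdot>\<^sub>m (1\<^sub>m n - U * (G * F))) $$ (i, k)" .
  qed (auto simp: nc_eval_def mat_sum_def UGF)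
  then show ?thesis
    using det c(1) by (simp add: pencil)
qed

section \<open>Families of matrices whose common kernel has codimension at most one\<close>

context vec_space
begin

section \<open>Dimension and linear independence in subspaces\<close>

lemma submodule_Inter_mat_kernel:
  fixes E :: "'i \<Rightarrow> 'a mat"
  assumes E: "\<And>j. E j \<in> carrier_mat m n"
  shows "submodule class_ring (\<Inter>j. mat_kernel (E j)) V"
proof (rule LinearCombinations.submodule.intro)
  show "module class_ring V" by (rule vec_module)
next
  show "(\<Inter>j. mat_kernel (E j)) \<subseteq> carrier V"
    using mat_kernelD[OF E] by auto
next
  have "E j *\<^sub>v 0\<^sub>v n = 0\<^sub>v m" for j using E[of j] by (intro eq_vecI) auto
  then show "\<zero>\<^bsub>V\<^esub> \<in> (\<Inter>j. mat_kernel (E j))"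
    by (auto intro!: mat_kernelI[OF E])
next
  fix v w assume "v \<in> (\<Inter>j. mat_kernel (E j))" "w \<in> (\<Inter>j. mat_kernel (E j))"
  then show "v \<oplus>\<^bsub>V\<^esub> w \<in> (\<Inter>j. mat_kernel (E j))"
    using mat_kernelD[OF E] by (auto intro!: mat_kernelI[OF E] simp: mult_add_distrib_mat_vec[OF E])
next
  fix c :: 'a and v assume "c \<in> carrier class_ring" "v \<in> (\<Inter>j. mat_kernel (E j))"
  then show "c \<odot>\<^bsub>V\<^esub> v \<in> (\<Inter>j. mat_kernel (E j))"
    using mat_kernelD[OF E] by (auto intro!: mat_kernelI[OF E] simp: mult_mat_vec[OF E])
qed

text \<open>Independent subsets of \<open>W\<close> have at most \<open>dim\<close> elements, so a
  maximal one exists and is a basis of \<open>W\<close>. The conclusion is phrased with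
  \<open>span\<close> and \<open>lin_indpt\<close> of the ambient space, so that the basis can be
  extended there.\<close>

lemma submodule_basis_exists:
  assumes W: "submodule class_ring W V"
  obtains B where "finite B" "B \<subseteq> W" "lin_indpt B" "span B = W"
    "vectorspace.dim class_ring (V\<lparr>carrier := W\<rparr>) = card B"
proof -
  interpret W: vectorspace class_ring "V\<lparr>carrier := W\<rparr>"
    by (rule subspace_is_vs) (unfold subspace_def, intro conjI vectorspace_axioms W)
  have WV: "W \<subseteq> carrier V" using W by (simp add: submodule_def)
  have indpt: "W.lin_dep S \<longleftrightarrow> lin_dep S" and span: "W.span S = span S" if "S \<subseteq> W" for S
    using span_li_not_depend[OF that W] by simp_all
  obtain B where B: "finite B" "maximal B (\<lambda>S. S \<subseteq> carrier (V\<lparr>carrier := W\<rparr>) \<and> \<not> W.lin_dep S)"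
  proof (rule exE[OF maximal_exists[where P = "\<lambda>S. S \<subseteq> carrier (V\<lparr>carrier := W\<rparr>) \<and> \<not> W.lin_dep S"
        and N = dim and B = "{}"]])
    show "{} \<subseteq> carrier (V\<lparr>carrier := W\<rparr>) \<and> \<not> W.lin_dep {}"
      by (auto simp: W.lin_dep_def)
    show "finite S \<and> card S \<le> dim" if "S \<subseteq> carrier (V\<lparr>carrier := W\<rparr>) \<and> \<not> W.lin_dep S" for S
      using li_le_dim[of S] that WV indpt[of S] by auto
  qed (use that in blast)
  have "W.basis B" by (rule W.max_li_is_basis[OF B(2)])
  then have "B \<subseteq> W" "\<not> W.lin_dep B" "W.span B = W" "W.dim = card B"
    using W.dim_basis[OF B(1)] by (auto simp: W.basis_def)
  with B(1) show ?thesis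
    using that indpt[of B] span[of B] by simp
qed

lemma card_le_dim_submodule:
  assumes "submodule class_ring W V" "S \<subseteq> W" "lin_indpt S"
  shows "card S \<le> vectorspace.dim class_ring (V\<lparr>carrier := W\<rparr>)"
proof -
  obtain B where B: "finite B" "B \<subseteq> W" "lin_indpt B" "span B = W"
    "vectorspace.dim class_ring (V\<lparr>carrier := W\<rparr>) = card B"
    using submodule_basis_exists[OF assms(1)] .
  have WV: "W \<subseteq> carrier V" using assms(1) by (simp add: submodule_def)
  have fin: "finite S" using li_le_dim(1)[of S] assms WV by auto
  have BV: "B \<subseteq> carrier_vec n" and SB: "S \<subseteq> span B" using assms B WV by auto
  \<comment> \<open>Steinitz exchange: \<open>card B - card S\<close> bounds the cardinality of a
    set and is therefore nonnegative as an integer.\<close>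
  obtain C :: "'a vec set" where "int (card C) \<le> int (card B) - int (card S)"
    using replacement[OF fin B(1) BV assms(3) SB] by blast
  then show ?thesis using B(5) by linarith
qed

lemma insert_lin_indpt:
  assumes "S \<subseteq> carrier_vec n" "lin_indpt S" "v \<in> carrier_vec n" "v \<notin> span S"
  shows "v \<notin> S" "lin_indpt (insert v S)"
proof -
  show "v \<notin> S" using in_own_span[OF assms(1)] assms(4) by (rule contra_subsetD)
  then show "lin_indpt (insert v S)"
    using lin_dep_iff_in_span[of S v] assms by simp
qed

text \<open>Unless all \<open>E j\<close> vanish, let \<open>u\<close> be a nonzero row of one of
  them. The common kernel lies in the hyperplane \<open>mat_kernel u\<close>, and the codimension
  bound forces equality. Every \<open>E k\<close> then vanishes on that hyperplane, so all its rows
  are multiples of \<open>u\<close>.\<close>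

lemma codim_le_1_imp_rank_one:
  fixes E :: "'g \<Rightarrow> 'a mat"
  assumes E: "\<And>j. E j \<in> carrier_mat n n" and codim: "codim n (\<Inter>j. mat_kernel (E j)) \<le> 1"
  shows "\<exists>u e. u \<in> carrier_mat 1 n \<and> (\<forall>j. e j \<in> carrier_mat n 1 \<and> E j = e j * u)"
proof (cases "\<exists>j i p. i < n \<and> p < n \<and> E j $$ (i, p) \<noteq> 0")
  case False
  have "E j = 0\<^sub>m n 1 * 0\<^sub>m 1 n" for j
    using False E[of j] by (intro eq_matI) auto
  then show ?thesis
    by (intro exI[of _ "0\<^sub>m 1 n"] exI[of _ "\<lambda>_. 0\<^sub>m n 1"]) auto
next
  case True
  then obtain j i p where jip: "i < n" "p < n" "E j $$ (i, p) \<noteq> 0" by blast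
  define u where "u = mat 1 n (\<lambda>(_, k). E j $$ (i, k))"
  define W where "W = (\<Inter>j. mat_kernel (E j))"
  have u: "u \<in> carrier_mat 1 n" "u $$ (0, p) \<noteq> 0" using jip by (auto simp: u_def)
  have subW: "submodule class_ring W V"
    unfolding W_def by (rule submodule_Inter_mat_kernel[OF E])
  have subK: "submodule class_ring (mat_kernel u) V"
    using submodule_Inter_mat_kernel[of "\<lambda>_::unit. u" 1] u by simp
  have WK: "W \<subseteq> mat_kernel u"
  proof
    fix v assume "v \<in> W"
    then have v: "v \<in> carrier_vec n" "E j *\<^sub>v v = 0\<^sub>v n"
      using mat_kernelD[OF E] by (auto simp: W_def)
    have "row u 0 = row (E j) i" using jip E[of j] by (intro eq_vecI) (auto simp: u_def)
    moreover have "row (E j) i \<bullet> v = 0"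
      using arg_cong[OF v(2), of "\<lambda>x. x $ i"] jip E[of j] by simp
    ultimately have "u *\<^sub>v v = 0\<^sub>v 1" using u by (intro eq_vecI) auto
    then show "v \<in> mat_kernel u" using u v by (intro mat_kernelI) auto
  qed
  obtain B where B: "finite B" "B \<subseteq> W" "lin_indpt B" "span B = W"
    "vectorspace.dim class_ring (V\<lparr>carrier := W\<rparr>) = card B"
    using submodule_basis_exists[OF subW] .
  have BV: "B \<subseteq> carrier_vec n" using B(2) subW by (auto simp: submodule_def)
  \<comment> \<open>A vector \<open>h\<close> of the hyperplane outside \<open>W\<close>, and then
    \<open>unit_vec n p\<close>, which lies outside the hyperplane because \<open>u\<close> has a
    nonzero entry at \<open>p\<close>, would extend a basis of \<open>W\<close> to
    \<open>card B + 2\<close> independent vectors, while the codimension bound gives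
    \<open>n \<le> card B + 1\<close>.\<close>
  have KW: "h \<in> W" if h: "h \<in> mat_kernel u" for h
  proof (rule ccontr)
    assume "h \<notin> W"
    have hV: "h \<in> carrier_vec n" using mat_kernelD[OF u(1) h] by simp
    have 1: "h \<notin> B" "lin_indpt (insert h B)"
      using insert_lin_indpt[OF BV B(3) hV] \<open>h \<notin> W\<close> B(4) by auto
    have "span (insert h B) \<subseteq> mat_kernel u"
      using subK h B(2) WK by (intro span_is_subset) auto
    moreover have "unit_vec n p \<notin> mat_kernel u"
    proof
      assume "unit_vec n p \<in> mat_kernel u"
      then have "u *\<^sub>v unit_vec n p = 0\<^sub>v 1" using mat_kernelD[OF u(1)] by auto
      from arg_cong[OF this, of "\<lambda>x. x $ 0"] show False
        using u jip by simp
    qed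
    ultimately have 2: "unit_vec n p \<notin> span (insert h B)" by auto
    have 3: "insert h B \<subseteq> carrier_vec n" "unit_vec n p \<in> carrier_vec n" using BV hV by auto
    note 4 = insert_lin_indpt[OF 3(1) 1(2) 3(2) 2]
    have "card (insert (unit_vec n p) (insert h B)) \<le> dim"
      using 3 4 by (intro li_le_dim) auto
    then have "card B + 2 \<le> n"
      using B(1) 1(1) 4(1) by (simp add: dim_is_n)
    moreover have "n \<le> card B + 1"
      using codim B(5) by (simp add: codim_def W_def)
    ultimately show False by simp
  qed
  \<comment> \<open>The column \<open>e k\<close> is column \<open>p\<close> of \<open>E k\<close>,
    normalised by the pivot entry of \<open>u\<close>.\<close>
  define e where "e k = mat n 1 (\<lambda>(i, _). E k $$ (i, p) / u $$ (0, p))" for k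
  have "E k = e k * u" for k
  proof (rule eq_matI)
    fix a b assume "a < dim_row (e k * u)" "b < dim_col (e k * u)"
    then have ab: "a < n" "b < n" using u by (auto simp: e_def)
    \<comment> \<open>This vector is in the kernel of \<open>u\<close> by construction; that
      \<open>E k\<close> kills it is the proportionality of columns \<open>b\<close> and
      \<open>p\<close> with ratio given by \<open>u\<close>.\<close>
    define h where "h = u $$ (0, p) \<cdot>\<^sub>v unit_vec n b - u $$ (0, b) \<cdot>\<^sub>v unit_vec n p"
    have h: "h \<in> carrier_vec n" by (simp add: h_def)
    have dot: "row A l \<bullet> h = u $$ (0, p) * A $$ (l, b) - u $$ (0, b) * A $$ (l, p)"
      if "A \<in> carrier_mat m n" "l < m" for A m l
    proof -
      have r: "row A l \<in> carrier_vec n" using that by auto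
      then show ?thesis
        using that jip ab unfolding h_def
        by (simp add: scalar_prod_minus_distrib[OF r])
    qed
    have "u *\<^sub>v h = 0\<^sub>v 1"
      using u dot[OF u(1)] by (intro eq_vecI) auto
    then have "h \<in> W" using KW mat_kernelI[OF u(1) h] by blast
    then have "E k *\<^sub>v h = 0\<^sub>v n" using mat_kernelD[OF E] by (auto simp: W_def)
    from arg_cong[OF this, of "\<lambda>x. x $ a"]
    have "u $$ (0, p) * E k $$ (a, b) = u $$ (0, b) * E k $$ (a, p)"
      using ab E[of k] dot[OF E, of a k] by simp
    then show "E k $$ (a, b) = (e k * u) $$ (a, b)"
      using ab u jip by (simp add: e_def scalar_prod_def field_simps)
  qed (use E u in \<open>auto simp: e_def\<close>)
  then show ?thesis using u by (intro exI[of _ u] exI[of _ e]) (auto simp: e_def)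
qed

text \<open>The unit vectors other than the first are annihilated by the row, and they are
  \<open>n - 1\<close> independent elements of the common kernel.\<close>

lemma codim_first_row_le_1:
  fixes e :: "'g \<Rightarrow> 'a mat"
  assumes e: "\<And>j. e j \<in> carrier_mat n 1"
  shows "codim n (\<Inter>j. mat_kernel (e j * mat 1 n (\<lambda>(_, k). if k = 0 then 1 else 0))) \<le> 1"
proof -
  let ?u = "mat 1 n (\<lambda>(_, k). if k = 0 then 1 else 0) :: 'a mat"
  let ?W = "\<Inter>j. mat_kernel (e j * ?u)"
  let ?S = "unit_vec n ` {1..<n} :: 'a vec set"
  have E: "e j * ?u \<in> carrier_mat n n" for j
    using e[of j] by (intro mult_carrier_mat) auto
  have "?S \<subseteq> ?W"
  proof (clarify intro!: INT_I)
    fix i j assume i: "i \<in> {1..<n}"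
    have "?u *\<^sub>v unit_vec n i = 0\<^sub>v 1" using i by (intro eq_vecI) auto
    moreover have "e j *\<^sub>v 0\<^sub>v 1 = 0\<^sub>v n" using e[of j] by (intro eq_vecI) auto
    ultimately have "e j * ?u *\<^sub>v unit_vec n i = 0\<^sub>v n"
      using e[of j] by (simp add: assoc_mult_mat_vec[of _ n 1 _ n])
    then show "unit_vec n i \<in> mat_kernel (e j * ?u)"
      by (intro mat_kernelI[OF E]) auto
  qed
  moreover have "lin_indpt ?S"
  proof (rule subset_li_is_li)
    show "lin_indpt (set (unit_vecs n))" using unit_vecs_basis by (simp add: basis_def)
    show "?S \<subseteq> set (unit_vecs n)" by (auto simp: unit_vecs_def)
  qed
  ultimately have "card ?S \<le> vectorspace.dim class_ring (V\<lparr>carrier := ?W\<rparr>)"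
    by (intro card_le_dim_submodule submodule_Inter_mat_kernel[OF E])
  moreover have "card ?S = n - 1"
    by (subst card_image) (auto simp: inj_on_def)
  ultimately show ?thesis by (simp add: codim_def)
qed

end

lemma flip_poly_imp_rank_one_perturbation:
  fixes A :: "'g \<Rightarrow> 'a::field mat"
  assumes "flip_poly d A"
  shows "\<exists>N u e. (\<forall>j. N j \<in> carrier_mat d d) \<and> jointly_nilpotent d N \<and> u \<in> carrier_mat 1 d \<and>
    (\<forall>j. e j \<in> carrier_mat d 1) \<and> A = (\<lambda>j. N j + e j * u)"
proof -
  obtain N E where NE: "\<And>j. N j \<in> carrier_mat d d" "\<And>j. E j \<in> carrier_mat d d"
      "\<And>j. A j = N j + E j" "jointly_nilpotent d N" "codim d (\<Inter>j. mat_kernel (E j)) \<le> 1"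
    using assms unfolding flip_poly_def by blast
  interpret vec_space "TYPE('a)" d .
  obtain u e where "u \<in> carrier_mat 1 d" "\<And>j. e j \<in> carrier_mat d 1" "\<And>j. E j = e j * u"
    using codim_le_1_imp_rank_one[OF NE(2,5)] by blast
  with NE show ?thesis by (intro exI[of _ N] exI[of _ u] exI[of _ e]) auto
qed

section \<open>Free loci\<close>

lemma free_locus_eqI:
  assumes "\<And>n X. (\<And>j. X j \<in> carrier_mat n n) \<Longrightarrow> det (h n X) = 0 \<longleftrightarrow> det (h' n X) = 0"
  shows "free_locus h = free_locus h'"
  unfolding free_locus_def using assms by blast

text \<open>Joint nilpotency leaves only finitely many nonzero coefficients in the series
  \<open>1 - u L^(-1) e\<close>, which is therefore a polynomial.\<close>

lemma flip_poly_free_locus_imp_ncpoly: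
  fixes A :: "'g::finite \<Rightarrow> 'a::field mat"
  assumes "flip_poly d A"
  shows "\<exists>f. const_term f \<noteq> 0 \<and> free_locus (nc_eval f) = free_locus (pencil_eval d A)"
proof -
  obtain N u e where N: "\<And>j. N j \<in> carrier_mat d d" and nil: "jointly_nilpotent d N"
    and u: "u \<in> carrier_mat 1 d" and e: "\<And>j. e j \<in> carrier_mat d 1" and A: "A = (\<lambda>j. N j + e j * u)"
    using flip_poly_imp_rank_one_perturbation[OF assms] by auto
  obtain m where m: "\<And>w. length w = m \<Longrightarrow> word_eval d N w = 0\<^sub>m d d"
    using nil unfolding jointly_nilpotent_def by blast
  \<comment> \<open>\<open>butlast\<close> and \<open>last\<close> split a nonempty word into the
    word indexing a product of the \<open>N j\<close> and the letter indexing
    \<open>e\<close>.\<close>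
  define a where "a v = (if v = [] then 1
    else - (u * word_eval d N (butlast v) * e (last v)) $$ (0, 0))" for v
  have "a v = 0" if "Suc m < length v" for v
    using word_eval_eq_0_if_length_ge[of N d m "butlast v", OF N m] that u e[of "last v"]
    by (auto simp: a_def)
  then have "{v. a v \<noteq> 0} \<subseteq> {v. length v < Suc (Suc m)}"
    by (auto simp: not_less_eq) (meson linorder_not_less not_less_eq)
  then have fin: "finite {v. a v \<noteq> 0}"
    using finite_words_length_less finite_subset by blast
  define f where "f = Abs_poly_mapping a"
  have f: "Poly_Mapping.lookup f = a"
    using fin by (simp add: f_def)
  have "free_locus (nc_eval f) = free_locus (pencil_eval d A)"
    unfolding A
    by (intro free_locus_eqI sym[OF det_pencil_eval_rank_one_perturbation[OF N _ nil u e, where c = 1]])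
      (auto simp: f a_def)
  moreover have "const_term f \<noteq> 0" by (simp add: const_term_def f a_def)
  ultimately show ?thesis by blast
qed

text \<open>A realization on the space spanned by the words of length at most \<open>D\<close>:
  \<open>u\<close> starts at the empty word, the product of the \<open>N j\<close> along
  \<open>w\<close> moves to \<open>w\<close>, and \<open>e j\<close> reads off the normalised
  coefficient of \<open>w @ [j]\<close>.\<close>

lemma ncpoly_free_locus_imp_flip_poly:
  fixes f :: "('g::finite, 'a::field) ncpoly"
  assumes c: "const_term f \<noteq> 0"
  shows "\<exists>d A. flip_poly d A \<and> free_locus (pencil_eval d A) = free_locus (nc_eval f)"
proof -
  define D where "D = Max (insert 0 (length ` Poly_Mapping.keys f))"
  have D: "Poly_Mapping.lookup f w = 0" if "length w > D" for w
  proof (rule ccontr)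
    assume "Poly_Mapping.lookup f w \<noteq> 0"
    then have "length w \<le> D" unfolding D_def by (intro Max_ge) (auto simp: in_keys_iff)
    with that show False by simp
  qed
  have "finite ({w :: 'g list. length w < Suc D} - {[]})"
    using finite_words_length_less by (rule finite_Diff)
  from finite_distinct_list[OF this]
  obtain vs where vs: "set vs = {w :: 'g list. length w < Suc D} - {[]}" "distinct vs"
    by blast
  \<comment> \<open>The empty word is put first, so that it has index 0, the only nonzero position
    of \<open>u\<close>.\<close>
  define ws where "ws = [] # vs"
  define d where "d = length ws"
  have "set ws = insert [] (set vs)" by (simp add: ws_def)
  also have "\<dots> = {w. length w < Suc D}" unfolding vs(1) by (simp add: insert_absorb)
  finally have set_ws: "set ws = {w. length w < Suc D}" .
  have "distinct ws" "ws ! 0 = []" and d: "0 < d"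
    using vs by (simp_all add: ws_def d_def)
  note ws = set_ws this(1,2)
  have nth_inj: "ws ! p = ws ! q \<longleftrightarrow> p = q" if "p < d" "q < d" for p q
    using that ws(2) by (simp add: d_def nth_eq_iff_index_eq)
  \<comment> \<open>The list \<open>ws\<close> has no repetitions, so at most one index survives;
    there is none when \<open>w\<close> is too long to be listed.\<close>
  have sum_ws: "(\<Sum>q<d. if ws ! q = w then g q else 0)
    = (if length w \<le> D then g (THE q. q < d \<and> ws ! q = w) else 0)" for w and g :: "nat \<Rightarrow> 'a"
  proof (cases "length w \<le> D")
    case True
    then have "w \<in> set ws" by (simp add: ws)
    then obtain q where q: "q < d" "ws ! q = w" by (auto simp: in_set_conv_nth d_def)
    then have "(THE q. q < d \<and> ws ! q = w) = q" using nth_inj by blast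
    moreover have "(\<Sum>r<d. if ws ! r = w then g r else 0) = (\<Sum>r<d. if r = q then g r else 0)"
      using q nth_inj by (intro sum.cong) auto
    ultimately show ?thesis using True q by simp
  next
    case False
    have "length (ws ! q) \<le> D" if "q < d" for q
      using nth_mem[of q ws] that by (simp add: ws d_def)
    with False show ?thesis by (auto intro!: sum.neutral)
  qed
  have The_nth: "ws ! (THE q. q < d \<and> ws ! q = w) = w" if "length w \<le> D" for w
  proof -
    have "w \<in> set ws" using that by (simp add: ws)
    then obtain q where q: "q < d" "ws ! q = w" by (auto simp: in_set_conv_nth d_def)
    then have "(THE q. q < d \<and> ws ! q = w) = q" using nth_inj by blast
    then show ?thesis using q by simp
  qed
  \<comment> \<open>Acting on row vectors, \<open>N j\<close> sends the basis vector of
    \<open>v\<close> to that of \<open>v @ [j]\<close>, or to 0 when \<open>v @ [j]\<close> is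
    longer than \<open>D\<close>.\<close>
  define N where "N j = mat d d (\<lambda>(p, q). if ws ! q = ws ! p @ [j] then 1 else 0 :: 'a)" for j
  have N: "N j \<in> carrier_mat d d" for j by (simp add: N_def)
  have Nw: "word_eval d N w $$ (p, q) = (if ws ! q = ws ! p @ w then 1 else 0)"
    if "p < d" "q < d" for w p q
    using that
  proof (induction w arbitrary: p)
    case Nil
    then show ?case using nth_inj by (auto simp: word_eval_Nil)
  next
    case (Cons j w)
    have W: "word_eval d N w \<in> carrier_mat d d" by (rule word_eval_carrier[OF N])
    have "word_eval d N (j # w) $$ (p, q) = (\<Sum>r<d. N j $$ (p, r) * word_eval d N w $$ (r, q))"
      unfolding word_eval_Cons using Cons.prems by (rule index_mult_mat_sum[OF N W])
    also have "\<dots> = (\<Sum>r<d. if ws ! r = ws ! p @ [j] then if ws ! q = ws ! r @ w then 1 else 0 else 0)"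
    proof (rule sum.cong)
      fix r assume "r \<in> {..<d}"
      with Cons.prems Cons.IH[of r]
      show "N j $$ (p, r) * word_eval d N w $$ (r, q)
        = (if ws ! r = ws ! p @ [j] then if ws ! q = ws ! r @ w then 1 else 0 else 0)"
        by (auto simp: N_def[of j])
    qed simp
    also have "\<dots> = (if length (ws ! p @ [j]) \<le> D then if ws ! q = (ws ! p @ [j]) @ w then 1 else 0 else 0)"
      by (subst sum_ws) (auto simp: The_nth)
    \<comment> \<open>The length test is absorbed: if the listed word \<open>ws ! q\<close> equals
      \<open>ws ! p @ j # w\<close>, its prefix \<open>ws ! p @ [j]\<close> has length at most
      \<open>D\<close> too.\<close>
    also have "\<dots> = (if ws ! q = ws ! p @ j # w then 1 else 0)"
      using nth_mem[of q ws] Cons.prems by (auto simp: ws d_def)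
    finally show ?case .
  qed
  have nil: "jointly_nilpotent d N"
    unfolding jointly_nilpotent_def
  proof (intro exI[of _ "Suc D"] allI impI)
    fix w :: "'g list" assume w: "length w = Suc D"
    show "word_eval d N w = 0\<^sub>m d d"
    proof (rule eq_matI)
      fix p q assume "p < dim_row (0\<^sub>m d d :: 'a mat)" "q < dim_col (0\<^sub>m d d :: 'a mat)"
      then have pq: "p < d" "q < d" by auto
      then have "length (ws ! q) < Suc D" using nth_mem[of q ws] by (simp add: ws d_def)
      then have "ws ! q \<noteq> ws ! p @ w" using w by auto
      then show "word_eval d N w $$ (p, q) = 0\<^sub>m d d $$ (p, q)" using pq by (simp add: Nw)
    qed (use word_eval_carrier[of N d w, OF N] in auto)
  qed
  define u where "u = mat 1 d (\<lambda>(_, k). if k = 0 then 1 else 0 :: 'a)"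
  \<comment> \<open>Dividing by the constant term normalises \<open>f\<close> to constant term 1;
    the sign comes from the minus in \<open>1 - u L^(-1) e\<close>.\<close>
  define e where "e j = mat d 1 (\<lambda>(p, _). - Poly_Mapping.lookup f (ws ! p @ [j]) / const_term f)" for j
  have u: "u \<in> carrier_mat 1 d" and e: "e j \<in> carrier_mat d 1" for j
    by (simp_all add: u_def e_def)
  have coeff: "Poly_Mapping.lookup f (w @ [j])
    = - const_term f * (u * word_eval d N w * e j) $$ (0, 0)" for w j
  proof -
    have W: "word_eval d N w \<in> carrier_mat d d" by (rule word_eval_carrier[OF N])
    have uW: "(u * word_eval d N w) $$ (0, q) = (if ws ! q = w then 1 else 0)" if "q < d" for q
    proof -
      have "(u * word_eval d N w) $$ (0, q) = (\<Sum>r<d. u $$ (0, r) * word_eval d N w $$ (r, q))"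
        using that by (intro index_mult_mat_sum[OF u W]) auto
      also have "\<dots> = (\<Sum>r<d. if r = 0 then word_eval d N w $$ (r, q) else 0)"
        by (intro sum.cong) (auto simp: u_def)
      also have "\<dots> = word_eval d N w $$ (0, q)" using d by simp
      finally show ?thesis using that d by (simp add: Nw ws)
    qed
    have "(u * word_eval d N w * e j) $$ (0, 0) = (\<Sum>q<d. (u * word_eval d N w) $$ (0, q) * e j $$ (q, 0))"
      by (rule index_mult_mat_sum[OF mult_carrier_mat[OF u W] e]) auto
    also have "\<dots> = (\<Sum>q<d. if ws ! q = w then - Poly_Mapping.lookup f (ws ! q @ [j]) / const_term f else 0)"
      by (intro sum.cong) (auto simp: uW e_def)
    \<comment> \<open>When \<open>w\<close> is longer than \<open>D\<close> the sum is empty of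
      nonzero terms, and the coefficient of \<open>w @ [j]\<close> is 0 by \<open>D\<close>.\<close>
    also have "\<dots> = - Poly_Mapping.lookup f (w @ [j]) / const_term f"
      by (subst sum_ws) (auto simp: The_nth D)
    finally show ?thesis using c by simp
  qed
  interpret vec_space "TYPE('a)" d .
  have "flip_poly d (\<lambda>j. N j + e j * u)"
    unfolding flip_poly_def monic_pencil_def
  proof (rule conjI, goal_cases)
    case 2
    have "codim d (\<Inter>j. mat_kernel (e j * u)) \<le> 1"
      unfolding u_def by (rule codim_first_row_le_1[OF e])
    with N nil mult_carrier_mat[OF e u] show ?case
      by (intro exI[of _ N] exI[of _ "\<lambda>j. e j * u"]) auto
  qed (use d N mult_carrier_mat[OF e u] in auto)
  moreover have "free_locus (pencil_eval d (\<lambda>j. N j + e j * u)) = free_locus (nc_eval f)"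
    using c by (intro free_locus_eqI det_pencil_eval_rank_one_perturbation[OF N _ nil u e _ _ coeff])
      (auto simp: const_term_def)
  ultimately show ?thesis by blast
qed

text \<open>The two preceding lemmas are the two inclusions. The condition on the constant term
  reflects that the origin is never on the locus of a monic pencil
  (\<open>origin_notin_free_locus_pencil_eval\<close>), but is on that of every \<open>f\<close>
  with zero constant term (\<open>origin_in_free_locus_nc_eval\<close>).\<close>

theorem corollary5p5:
  shows "{free_locus (nc_eval f) | f :: ('g::finite, 'a::{alg_closed_field, field_char_0}) ncpoly.
            const_term f \<noteq> 0}
       = {free_locus (pencil_eval d A) | d (A :: 'g \<Rightarrow> 'a mat). flip_poly d A}"
proof (intro subset_antisym subsetI)
  fix Z assume "Z \<in> {free_locus (nc_eval f) | f :: ('g, 'a) ncpoly. const_term f \<noteq> 0}"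
  then show "Z \<in> {free_locus (pencil_eval d A) | d (A :: 'g \<Rightarrow> 'a mat). flip_poly d A}"
    using ncpoly_free_locus_imp_flip_poly by fastforce
next
  fix Z assume "Z \<in> {free_locus (pencil_eval d A) | d (A :: 'g \<Rightarrow> 'a mat). flip_poly d A}"
  then show "Z \<in> {free_locus (nc_eval f) | f :: ('g, 'a) ncpoly. const_term f \<noteq> 0}"
    using flip_poly_free_locus_imp_ncpoly by fastforce
qed

end
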